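(* Let $b,c\in\mathbb{R}$ with $b>0$ and $c>0$, and let $\Phi:=Y^2+bX^2+c\in\mathbb{R}[X,Y]$. Then the affine $\mathbb{R}$-domain $\mathrm{L}_{b,c}:=\mathbb{R}[X,Y]/\langle\Phi\rangle$ is a principal ideal domain and is not a Euclidean domain.
   Context: A Euclidean function on an integral domain $A$ is a map $\delta:A\smallsetminus\{0\}\to\mathbb{N}$ such that for all $a,b\in A$ with $b\neq0$ there exist $q,r\in A$ with $a=qb+r$ and either $r=0$ or $\delta(r)<\delta(b)$. An integral domain is called a Euclidean domain if there exists a Euclidean function on it. An affine $\mathbb{R}$-domain is an integral domain that is a finitely generated $\mathbb{R}$-algebra. *)

theory Defs
  imports "HOL-Algebra.Algebraic_Closure_Type"
begin

text \<open>
  The ring of polynomials in two variables over the reals is taken as the iterated polynomial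
  ring \<open>\<real>[X][Y]\<close>: the inner type constructor adjoins \<open>X\<close>, the outer one adjoins \<open>Y\<close>, and
  a real \<open>a\<close> is embedded as \<open>[:[:a:]:]\<close>.
\<close>

abbreviation RXY :: "real poly poly ring" where
  "RXY \<equiv> ring_of_type_algebra"

definition const_XY :: "real \<Rightarrow> real poly poly" where
  "const_XY a = [:[:a:]:]"

definition var_X :: "real poly poly" where
  "var_X = [:[:0, 1:]:]"

definition var_Y :: "real poly poly" where
  "var_Y = [:0, 1:]"

definition Phi :: "real \<Rightarrow> real \<Rightarrow> real poly poly" where
  "Phi b c = var_Y ^ 2 + const_XY b * var_X ^ 2 + const_XY c"

definition L_ring :: "real \<Rightarrow> real \<Rightarrow> real poly poly set ring" where
  "L_ring b c = RXY Quot (Idl\<^bsub>RXY\<^esub> {Phi b c})"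

end

theory Submission
  imports Defs
begin

text \<open>
  Every class modulo \<open>\<Phi>\<close> has a unique representative \<open>p + q Y\<close> with \<open>p, q \<in> \<real>[X]\<close>, and
  \<open>p\<^sup>2 + (b X\<^sup>2 + c) q\<^sup>2\<close> is a multiplicative norm; hence \<open>\<Phi>\<close> is prime and the units of the
  quotient are the real constants.

  Not Euclidean: modulo a nonunit \<open>u\<close> of least Euclidean value every class is a real constant,
  so \<open>X \<equiv> s\<close>, \<open>Y \<equiv> t\<close> and \<open>u\<close> divides the positive real \<open>t\<^sup>2 + b s\<^sup>2 + c\<close>, a contradiction.

  Principal: filter by \<open>deg p \<le> n\<close>, \<open>deg q < n\<close>. Each graded piece of level \<open>n > 0\<close> is a plane,
  and multiples of any one element of level \<open>d > 0\<close> fill all the planes above \<open>d\<close>. So if \<open>d\<close> is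
  the lowest level met by an ideal and the ideal contains only a line at level \<open>d\<close>, it is principal.
  If it contained a plane at level \<open>d\<close>, with elements \<open>f, g\<close> of leading parts \<open>(1, 0), (0, 1)\<close>,
  then \<open>b X f + Y g\<close> and \<open>X g - Y f\<close> would drop to level \<open>d\<close> and so be real combinations
  of \<open>f\<close> and \<open>g\<close>. The determinant of these two relations vanishes, which gives
  \<open>b \<beta>\<^sup>2 + \<alpha>\<^sup>2 + c = 0\<close> with real \<open>\<alpha>, \<beta>\<close>, a contradiction.
\<close>

section \<open>Normal forms modulo \<open>Phi\<close>, the norm, and primality\<close>

lemma dvd_diff_swap: "a dvd b - c \<Longrightarrow> a dvd c - b" for a :: "'a :: comm_ring_1"
  by (metis dvd_minus_iff minus_diff_eq)

lemma Phi_eq: "Phi b c = [:[:c, 0, b:], 0, 1:]"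
  by (simp add: Phi_def var_X_def var_Y_def const_XY_def power2_eq_square)

text \<open>\<open>Phi\<close> is monic of degree 2 in \<open>Y\<close>, so division by it leaves a
  remainder linear in \<open>Y\<close>.\<close>

lemma Phi_reduce: "\<exists>p q. Phi b c dvd F - [:p, q:]"
proof (induction F)
  case 0
  show ?case by (rule exI[of _ 0], rule exI[of _ 0]) simp
next
  case (pCons a F)
  then obtain p q Q where Q: "F - [:p, q:] = Phi b c * Q" by (auto elim: dvdE)
  \<comment> \<open>Horner step: in \<open>Y (p + q Y)\<close>, the square \<open>Y^2\<close> is
    replaced by \<open>-(b X^2 + c)\<close>.\<close>
  have "pCons a F - [:a - [:c, 0, b:] * q, p:] = var_Y * (F - [:p, q:]) + Phi b c * [:q:]"
    by (simp add: Phi_eq var_Y_def algebra_simps)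
  also have "Phi b c dvd \<dots>" unfolding Q by (intro dvd_add dvd_mult dvd_triv_left)
  finally show ?case by blast
qed

text \<open>A degree comparison in \<open>Y\<close>; it makes normal forms unique.\<close>

lemma Phi_dvd_linear: "Phi b c dvd [:p, q:] \<Longrightarrow> p = 0 \<and> q = 0"
  using dvd_imp_degree_le[of "Phi b c" "[:p, q:]"] by (cases "q = 0") (auto simp: Phi_eq)

text \<open>At every real point both summands are nonnegative and the factor
  \<open>c + b x^2\<close> is positive, so \<open>p\<close> and \<open>q\<close> vanish
  pointwise.\<close>

lemma norm_eq_0:
  fixes p q :: "real poly"
  assumes "b > 0" "c > 0" "p * p + [:c, 0, b:] * q * q = 0"
  shows "p = 0 \<and> q = 0"
proof -
  have "poly p x = 0 \<and> poly q x = 0" for x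
  proof -
    have "(poly p x)\<^sup>2 + (c + b * x\<^sup>2) * (poly q x)\<^sup>2 = poly (p * p + [:c, 0, b:] * q * q) x"
      by (simp add: power2_eq_square algebra_simps)
    then have *: "(poly p x)\<^sup>2 + (c + b * x\<^sup>2) * (poly q x)\<^sup>2 = 0"
      by (simp only: assms(3) poly_0)
    have "c + b * x\<^sup>2 > 0" using assms by (simp add: add_pos_nonneg)
    moreover from this have "(c + b * x\<^sup>2) * (poly q x)\<^sup>2 = 0"
      using * by (smt (verit) mult_nonneg_nonneg zero_le_power2)
    ultimately show ?thesis using * by auto
  qed
  then show ?thesis by (simp add: poly_eq_poly_eq_iff[symmetric] fun_eq_iff)
qed

text \<open>Expanding with \<open>Y^2 = -(b X^2 + c)\<close> and using uniqueness of normal forms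
  gives the coordinates of a product.\<close>

lemma Phi_dvd_linear_mult:
  assumes "Phi b c dvd [:p, q:] * [:r, s:] - [:u, v:]"
  shows "u = p * r - [:c, 0, b:] * q * s \<and> v = p * s + q * r"
proof -
  have "[:p * r - [:c, 0, b:] * q * s - u, p * s + q * r - v:]
      = ([:p, q:] * [:r, s:] - [:u, v:]) - Phi b c * [:q * s:]"
    by (simp add: Phi_eq algebra_simps)
  also have "Phi b c dvd \<dots>" by (intro dvd_diff assms dvd_triv_left)
  finally show ?thesis by (auto dest: Phi_dvd_linear)
qed

lemma prime_Phi:
  assumes "b > 0" "c > 0"
  shows "prime_elem (Phi b c)"
proof (rule prime_elemI)
  show "Phi b c \<noteq> 0" by (simp add: Phi_eq)
  show "\<not> is_unit (Phi b c)"
    using Phi_dvd_linear[of b c 1 0] by (auto simp: one_pCons)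
  fix F G assume FG: "Phi b c dvd F * G"
  obtain p q where F: "Phi b c dvd F - [:p, q:]" using Phi_reduce by blast
  obtain r s where G: "Phi b c dvd G - [:r, s:]" using Phi_reduce by blast
  let ?N = "\<lambda>p q. p * p + [:c, 0, b:] * q * q"
  have "[:p, q:] * [:r, s:] = F * G - (F - [:p, q:]) * G - [:p, q:] * (G - [:r, s:])"
    by (simp only: algebra_simps)
  also have "Phi b c dvd \<dots>" by (rule dvd_diff[OF dvd_diff[OF FG dvd_mult2[OF F]] dvd_mult[OF G]])
  finally have "Phi b c dvd [:p, q:] * [:r, s:] - [:0, 0:]" by (simp only: pCons_0_0 diff_zero)
  from Phi_dvd_linear_mult[OF this]
  have *: "p * r - [:c, 0, b:] * q * s = 0" "p * s + q * r = 0" by auto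
  \<comment> \<open>Brahmagupta's identity: the norm is multiplicative. Here both squares on the
    right are zero.\<close>
  have "?N p q * ?N r s = (p * r - [:c, 0, b:] * q * s)^2 + [:c, 0, b:] * (p * s + q * r)^2"
    by (simp only: power2_eq_square algebra_simps)
  then have "?N p q = 0 \<or> ?N r s = 0" unfolding * by simp
  then have "[:p, q:] = 0 \<or> [:r, s:] = 0" using norm_eq_0[OF assms] by (metis pCons_0_0)
  then show "Phi b c dvd F \<or> Phi b c dvd G" using F G by (metis diff_zero)
qed

section \<open>Units of the quotient\<close>

text \<open>Nonnegative leading coefficients cannot cancel.\<close>

lemma degree_add_lead_coeff_pos:
  fixes p q :: "'a :: linordered_idom poly"
  assumes "lead_coeff p \<ge> 0" "lead_coeff q \<ge> 0"
  shows "degree (p + q) = max (degree p) (degree q)"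
proof (cases "degree p" "degree q" rule: linorder_cases)
  case equal
  show ?thesis
  proof (cases "p = 0 \<or> q = 0")
    case False
    then have "coeff (p + q) (degree p) > 0"
      using assms equal by (metis add_pos_pos coeff_add leading_coeff_0_iff order_le_less)
    then show ?thesis
      using equal degree_add_le_max[of p q] le_degree[of "p + q" "degree p"] by simp
  qed auto
qed (simp_all add: degree_add_eq_left degree_add_eq_right)

text \<open>As \<open>b > 0\<close>, the two summands of the norm do not cancel in top degree, and a
  nonzero \<open>q\<close> would contribute degree at least 2.\<close>

lemma norm_degree_0:
  fixes p q :: "real poly"
  assumes "b > 0" "degree (p * p + [:c, 0, b:] * q * q) = 0"
  shows "degree p = 0 \<and> q = 0"
proof -
  have "degree (p * p + [:c, 0, b:] * q * q) = max (degree (p * p)) (degree ([:c, 0, b:] * q * q))"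
    using assms(1) by (intro degree_add_lead_coeff_pos) (simp_all only: lead_coeff_mult, auto simp: mult.assoc)
  then have *: "degree (p * p) = 0" "degree ([:c, 0, b:] * q * q) = 0" using assms(2) by auto
  have "q = 0"
  proof (rule ccontr)
    assume "q \<noteq> 0"
    moreover have "degree [:c, 0, b:] = 2" "[:c, 0, b:] \<noteq> 0" using assms(1) by auto
    ultimately have "degree ([:c, 0, b:] * q * q) = 2 + degree q + degree q"
      by (metis degree_mult_eq mult_eq_0_iff)
    with * show False by simp
  qed
  moreover have "degree p = 0" using *(1) by (cases "p = 0") (auto simp: degree_mult_eq)
  ultimately show ?thesis by simp
qed

text \<open>By multiplicativity the norm of a unit divides 1, so it has degree 0.\<close>

lemma unit_mod_Phi_const:
  assumes "b > 0" "c > 0" "Phi b c dvd F * G - 1"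
  shows "\<exists>a. Phi b c dvd F - const_XY a"
proof -
  obtain p q where F: "Phi b c dvd F - [:p, q:]" using Phi_reduce by blast
  obtain r s where G: "Phi b c dvd G - [:r, s:]" using Phi_reduce by blast
  let ?N = "\<lambda>p q. p * p + [:c, 0, b:] * q * q"
  have "[:p, q:] * [:r, s:] - [:1, 0:] = (F * G - 1) - (F - [:p, q:]) * G - [:p, q:] * (G - [:r, s:])"
    unfolding pCons_0_0 one_pCons[symmetric] by (simp only: algebra_simps)
  also have "Phi b c dvd \<dots>" by (rule dvd_diff[OF dvd_diff[OF assms(3) dvd_mult2[OF F]] dvd_mult[OF G]])
  finally have "Phi b c dvd [:p, q:] * [:r, s:] - [:1, 0:]" .
  from Phi_dvd_linear_mult[OF this]
  have *: "p * r - [:c, 0, b:] * q * s = 1" "p * s + q * r = 0" by auto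
  have "?N p q * ?N r s = (p * r - [:c, 0, b:] * q * s)^2 + [:c, 0, b:] * (p * s + q * r)^2"
    by (simp only: power2_eq_square algebra_simps)
  then have "?N p q * ?N r s = 1" using * by simp
  then have "degree (?N p q) = 0"
    by (metis dvd_triv_left is_unit_iff_degree one_neq_zero mult_zero_left)
  with norm_degree_0[OF assms(1)] have "degree p = 0" "q = 0" by blast+
  with F show ?thesis by (metis const_XY_def degree_eq_zeroE pCons_0_0)
qed

section \<open>Absence of a Euclidean function\<close>

text \<open>Stated on representatives: divisibility by \<open>Phi\<close> means being zero in the
  quotient, and \<open>e\<close> is to be a Euclidean function composed with the projection.\<close>

lemma no_euclidean_mod_Phi:
  fixes e :: "real poly poly \<Rightarrow> nat"
  assumes "b > 0" "c > 0"
    and e: "\<And>A B. \<not> Phi b c dvd A \<Longrightarrow> \<not> Phi b c dvd B \<Longrightarrow>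
      \<exists>q r. Phi b c dvd A - (B * q + r) \<and> (Phi b c dvd r \<or> e r < e B)"
  shows False
proof -
  let ?P = "Phi b c"
  \<comment> \<open>Representatives of the nonzero nonunits of the quotient; \<open>var_X\<close>
    shows that there are some.\<close>
  define U where "U = {u. \<not> ?P dvd u \<and> (\<forall>v. \<not> ?P dvd u * v - 1)}"
  have X: "\<not> ?P dvd var_X - const_XY a" for a
    using Phi_dvd_linear[of b c "[:-a, 1:]" 0] by (auto simp: var_X_def const_XY_def)
  have Y: "\<not> ?P dvd var_Y"
    using Phi_dvd_linear[of b c 0 1] by (auto simp: var_Y_def)
  have "var_X \<in> U"
    using X[of 0] X unit_mod_Phi_const[OF assms(1,2)] unfolding U_def
    by (auto simp: const_XY_def)
  then obtain u where u: "u \<in> U" and min: "\<And>v. v \<in> U \<Longrightarrow> e u \<le> e v"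
    using ex_has_least_nat[of "\<lambda>u. u \<in> U" var_X e] by blast
  have red: "\<exists>q a. ?P dvd A - (u * q + const_XY a)" if A: "\<not> ?P dvd A" for A
  proof -
    obtain q r where qr: "?P dvd A - (u * q + r)" "?P dvd r \<or> e r < e u"
      using e[OF A, of u] u by (auto simp: U_def)
    \<comment> \<open>By minimality of \<open>u\<close>, a remainder of smaller value is zero or a
      unit, hence a constant class.\<close>
    from qr(2) have "r \<notin> U \<or> ?P dvd r" using min[of r] by auto
    then have "?P dvd r \<or> (\<exists>v. ?P dvd r * v - 1)" by (auto simp: U_def)
    then obtain a where a: "?P dvd r - const_XY a"
    proof
      assume "?P dvd r"
      then show ?thesis using that[of 0] by (simp add: const_XY_def)
    qed (use unit_mod_Phi_const[OF assms(1,2)] in blast)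
    have "A - (u * q + const_XY a) = (A - (u * q + r)) + (r - const_XY a)" by simp
    with a qr(1) show ?thesis by (metis dvd_add)
  qed
  obtain q s where q: "?P dvd var_X - (u * q + const_XY s)"
    using red[of var_X] X[of 0] by (auto simp: const_XY_def)
  obtain q' t where q': "?P dvd var_Y - (u * q' + const_XY t)"
    using red[OF Y] by auto
  \<comment> \<open>The value of \<open>Phi\<close> at the real point \<open>(s, t)\<close>. Since
    \<open>X\<close> and \<open>Y\<close> are congruent to \<open>s\<close> and \<open>t\<close>
    modulo \<open>u\<close> and \<open>Phi\<close>, so is \<open>Phi\<close> to
    \<open>k\<close>.\<close>
  define k where "k = t\<^sup>2 + b * s\<^sup>2 + c"
  have k: "k > 0" using assms unfolding k_def by (simp add: add_nonneg_pos)
  define x0 y0 B where "x0 = const_XY s" "y0 = const_XY t" "B = const_XY b"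
  have K: "const_XY k = y0 * y0 + B * x0 * x0 + const_XY c"
    by (simp add: k_def x0_y0_B_def const_XY_def power2_eq_square)
  obtain d where d: "var_X = ?P * d + u * q + x0"
    using q by (auto simp: x0_y0_B_def algebra_simps elim!: dvdE)
  obtain d' where d': "var_Y = ?P * d' + u * q' + y0"
    using q' by (auto simp: x0_y0_B_def algebra_simps elim!: dvdE)
  have "?P = var_Y * var_Y + B * var_X * var_X + const_XY c"
    by (simp add: Phi_def x0_y0_B_def power2_eq_square)
  then have "const_XY k = ?P - (var_Y * var_Y - y0 * y0) - B * (var_X * var_X - x0 * x0)"
    using K by (simp add: algebra_simps)
  also have "\<dots> = ?P * (1 - d' * (var_Y + y0) - B * d * (var_X + x0))
      - u * (q' * (var_Y + y0) + B * q * (var_X + x0))"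
  proof -
    have "var_Y * var_Y - y0 * y0 = (?P * d' + u * q') * (var_Y + y0)"
      using d' by (metis (no_types, opaque_lifting) add_diff_cancel_right' square_diff_square_factored mult.commute)
    moreover have "var_X * var_X - x0 * x0 = (?P * d + u * q) * (var_X + x0)"
      using d by (metis (no_types, opaque_lifting) add_diff_cancel_right' square_diff_square_factored mult.commute)
    ultimately show ?thesis by (simp only:) (simp only: algebra_simps)
  qed
  finally obtain M N where "const_XY k = ?P * M - u * N" by blast
  then have kMN: "?P * M - u * N = const_XY k" ..
  \<comment> \<open>Dividing by the nonzero real \<open>k\<close> makes \<open>u\<close> a unit
    modulo \<open>Phi\<close>.\<close>
  define K where "K = const_XY (1 / k)"
  have "const_XY k * K = 1" using k by (simp add: K_def const_XY_def one_pCons)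
  then have "u * (- N * K) - 1 = (?P * M - u * N) * K - ?P * (M * K) - const_XY k * K"
    by (simp only: mult_minus_left mult_minus_right algebra_simps)
  then have "u * (- N * K) - 1 = - (?P * (M * K))" unfolding kMN by simp
  then have "?P dvd u * (- N * K) - 1" by (simp only: dvd_minus_iff dvd_triv_left)
  with u show False unfolding U_def by blast
qed


section \<open>The filtration by level\<close>

text \<open>The total-degree filtration of \<open>p + q Y\<close>, with \<open>X\<close> and
  \<open>Y\<close> of weight 1. Vanishing coefficients, unlike the bound
  \<open>degree q < n\<close>, allow \<open>q = 0\<close> at level 0. The leading pair at level
  \<open>Suc m\<close> is \<open>(coeff p (Suc m), coeff q m)\<close>.\<close>

definition in_level :: "nat \<Rightarrow> 'a :: zero poly \<Rightarrow> 'a poly \<Rightarrow> bool" where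
  "in_level n p q \<longleftrightarrow> (\<forall>k>n. coeff p k = 0) \<and> (\<forall>k\<ge>n. coeff q k = 0)"

lemma ex_in_level: "\<exists>n. in_level n p q"
  by (rule exI[of _ "max (degree p) (Suc (degree q))"]) (auto simp: in_level_def coeff_eq_0)

lemma in_level_comb:
  fixes p q r s :: "'a :: comm_ring_1 poly"
  shows "in_level n p q \<Longrightarrow> in_level n r s \<Longrightarrow>
    in_level n (smult l p + smult m r) (smult l q + smult m s)"
  by (simp add: in_level_def)

lemma in_level_Suc_drop:
  "in_level (Suc n) p q \<Longrightarrow> coeff p (Suc n) = 0 \<Longrightarrow> coeff q n = 0 \<Longrightarrow> in_level n p q"
  by (auto simp: in_level_def) (metis Suc_lessI, metis Suc_leI le_neq_implies_less)

lemma in_level_times_X: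
  "in_level n p q \<Longrightarrow> in_level (Suc n) (pCons 0 p) (pCons 0 q)"
  by (auto simp: in_level_def coeff_pCons split: nat.splits)

text \<open>The new pair is the normal form of \<open>Y (p + q Y)\<close>.\<close>

lemma in_level_times_Y:
  fixes p q :: "'a :: comm_ring_1 poly"
  shows "in_level n p q \<Longrightarrow> in_level (Suc n) (- ([:c, 0, b:] * q)) p"
  by (auto simp: in_level_def coeff_pCons split: nat.splits)

lemma linear_times_var_Y: "Phi b c dvd var_Y * [:p, q:] - [:- ([:c, 0, b:] * q), p:]"
proof -
  have "var_Y * [:p, q:] - [:- ([:c, 0, b:] * q), p:] = Phi b c * [:q:]"
    by (simp add: Phi_eq var_Y_def algebra_simps)
  then show ?thesis by (simp only: dvd_triv_left)
qed

lemma linear_times_var_X: "var_X * [:p, q:] = [:pCons 0 p, pCons 0 q:]"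
  by (simp add: var_X_def)

lemma linear_comb:
  "[:smult l p + smult m r, smult l q + smult m s:] = const_XY l * [:p, q:] + const_XY m * [:r, s:]"
  by (simp add: const_XY_def)

text \<open>On leading pairs \<open>X\<close> acts as the identity and \<open>Y\<close> as
  \<open>(u, v) -> (-b v, u)\<close>. One level up, real combinations of the two reach every pair;
  from there multiplication by \<open>X\<close> carries the pair upwards.\<close>

lemma multiples_all_leads:
  fixes p q :: "real poly"
  assumes "b > 0" and f: "in_level (Suc m) p q" and uv: "coeff p (Suc m) \<noteq> 0 \<or> coeff q m \<noteq> 0"
    and "n > m"
  shows "\<exists>k r s. Phi b c dvd [:r, s:] - k * [:p, q:] \<and> in_level (Suc n) r s \<and>
    coeff r (Suc n) = x \<and> coeff s n = y"
  using \<open>n > m\<close>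
proof (induction n)
  case (Suc n)
  show ?case
  proof (cases "m < n")
    case True
    with Suc.IH obtain k r s where "Phi b c dvd [:r, s:] - k * [:p, q:]" "in_level (Suc n) r s"
      "coeff r (Suc n) = x" "coeff s n = y" by blast
    moreover have "[:pCons 0 r, pCons 0 s:] - (var_X * k) * [:p, q:]
      = var_X * ([:r, s:] - k * [:p, q:])"
      by (simp only: linear_times_var_X[symmetric] algebra_simps)
    ultimately show ?thesis
      by (intro exI[of _ "var_X * k"] exI[of _ "pCons 0 r"] exI[of _ "pCons 0 s"])
        (simp only: in_level_times_X coeff_pCons_Suc dvd_mult simp_thms)
  next
    case False
    with Suc have [simp]: "n = m" by simp
    \<comment> \<open>\<open>e\<close> is the determinant of the system
      \<open>l u - \<mu> b v = x\<close>, \<open>l v + \<mu> u = y\<close>, which is then solved by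
      Cramer's rule.\<close>
    define u v e where "u = coeff p (Suc m)" "v = coeff q m" "e = u\<^sup>2 + b * v\<^sup>2"
    have "e > 0" using uv \<open>b > 0\<close>
      by (auto simp: u_v_e_def add_pos_nonneg add_nonneg_pos)
    define l \<mu> where "l = (x * u + y * b * v) / e" "\<mu> = (y * u - x * v) / e"
    let ?r = "smult l (pCons 0 p) + smult \<mu> (- ([:c, 0, b:] * q))"
    let ?s = "smult l (pCons 0 q) + smult \<mu> p"
    have "l * u - \<mu> * b * v = x * (u\<^sup>2 + b * v\<^sup>2) / e"
      by (simp add: l_\<mu>_def power2_eq_square diff_divide_distrib add_divide_distrib algebra_simps)
    then have 1: "l * u - \<mu> * b * v = x" using \<open>e > 0\<close> by (simp add: u_v_e_def(3))
    have "l * v + \<mu> * u = y * (u\<^sup>2 + b * v\<^sup>2) / e"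
      by (simp add: l_\<mu>_def power2_eq_square diff_divide_distrib add_divide_distrib algebra_simps)
    then have 2: "l * v + \<mu> * u = y" using \<open>e > 0\<close> by (simp add: u_v_e_def(3))
    \<comment> \<open>Removes the contribution of \<open>c\<close> to the top coefficient of
      \<open>?r\<close>.\<close>
    have q0: "coeff q (Suc (Suc m)) = 0" using f by (simp add: in_level_def)
    have "in_level (Suc (Suc m)) ?r ?s"
      by (intro in_level_comb in_level_times_X in_level_times_Y f)
    moreover have "coeff ?r (Suc (Suc m)) = x" "coeff ?s (Suc m) = y"
      using 1 2 q0 by (simp_all add: u_v_e_def)
    moreover have "Phi b c dvd [:?r, ?s:] - (const_XY l * var_X + const_XY \<mu> * var_Y) * [:p, q:]"
    proof -
      have "[:?r, ?s:] - (const_XY l * var_X + const_XY \<mu> * var_Y) * [:p, q:]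
        = - (const_XY \<mu> * (var_Y * [:p, q:] - [:- ([:c, 0, b:] * q), p:]))"
        unfolding linear_comb linear_times_var_X[symmetric] by (simp only: algebra_simps)
      then show ?thesis using linear_times_var_Y[of b c p q] by (simp only: dvd_minus_iff dvd_mult)
    qed
    ultimately show ?thesis unfolding \<open>n = m\<close> by blast
  qed
qed simp

section \<open>Principality of the ideals containing \<open>Phi\<close>\<close>

lemma ideal_mod_Phi_principal:
  assumes bc: "b > 0" "c > 0"
    and add: "\<And>F G. F \<in> J \<Longrightarrow> G \<in> J \<Longrightarrow> F + G \<in> J"
    and mult: "\<And>F G. F \<in> J \<Longrightarrow> G * F \<in> J"
    and Phi: "Phi b c \<in> J"
  shows "\<exists>f\<in>J. \<forall>h\<in>J. \<exists>k. Phi b c dvd h - k * f"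
proof -
  let ?P = "Phi b c"
  have mem: "F \<in> J" if "?P dvd F - G" "G \<in> J" for F G
  proof -
    obtain Q where "F - G = ?P * Q" using \<open>?P dvd F - G\<close> by (elim dvdE)
    then have "F = Q * ?P + G" by (simp add: algebra_simps)
    with that add mult Phi show ?thesis by metis
  qed
  have comb: "[:smult l p + smult m r, smult l q + smult m s:] \<in> J"
    if "[:p, q:] \<in> J" "[:r, s:] \<in> J" for p q r s l m
    unfolding linear_comb by (intro add mult that)
  have Xmem: "[:pCons 0 p, pCons 0 q:] \<in> J" if "[:p, q:] \<in> J" for p q
    unfolding linear_times_var_X[symmetric] by (intro mult that)
  have Ymem: "[:- ([:c, 0, b:] * q), p:] \<in> J" if "[:p, q:] \<in> J" for p q
    by (rule mem[OF dvd_diff_swap[OF linear_times_var_Y] mult[OF that]])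
  show ?thesis
  proof (cases "\<exists>p q. [:p, q:] \<in> J \<and> [:p, q:] \<noteq> 0")
    \<comment> \<open>\<open>J\<close> consists of the multiples of \<open>Phi\<close> only: the
      zero ideal of the quotient.\<close>
    case False
    have "?P dvd h" if h: "h \<in> J" for h
    proof -
      obtain p q where pq: "?P dvd h - [:p, q:]" using Phi_reduce by blast
      then have "[:p, q:] \<in> J" using mem[OF dvd_diff_swap h] by blast
      with False have "[:p, q:] = 0" by blast
      with pq show ?thesis by (simp only: diff_zero)
    qed
    then show ?thesis using Phi by (intro bexI[of _ ?P] ballI exI[of _ 0]) auto
  next
    case True
    define d where "d = (LEAST n. \<exists>p q. [:p, q:] \<in> J \<and> [:p, q:] \<noteq> 0 \<and> in_level n p q)"
    have "\<exists>n p q. [:p, q:] \<in> J \<and> [:p, q:] \<noteq> 0 \<and> in_level n p q"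
      using True ex_in_level by blast
    then have "\<exists>p q. [:p, q:] \<in> J \<and> [:p, q:] \<noteq> 0 \<and> in_level d p q"
      unfolding d_def by (rule LeastI_ex)
    then obtain p q where f: "[:p, q:] \<in> J" "[:p, q:] \<noteq> 0" "in_level d p q" by blast
    have low: "r = 0 \<and> s = 0" if "[:r, s:] \<in> J" "in_level n r s" "n < d" for r s n
      using not_less_Least[of n "\<lambda>n. \<exists>p q. [:p, q:] \<in> J \<and> [:p, q:] \<noteq> 0 \<and> in_level n p q"]
        that unfolding d_def by auto
    show ?thesis
    proof (cases d)
      \<comment> \<open>At level 0 the element is a nonzero real, hence a unit.\<close>
      case 0
      then have q: "q = 0" using f(3) by (auto simp: in_level_def poly_eq_iff)
      have "p = [:coeff p 0:]" using f(3) 0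
        by (auto simp: in_level_def poly_eq_iff coeff_pCons split: nat.splits)
      then obtain a where p: "p = [:a:]" by blast
      have "const_XY (1 / a) * [:p, q:] = 1" using p q f(2) by (auto simp: const_XY_def one_pCons)
      then have "h - h * const_XY (1 / a) * [:p, q:] = 0" for h
        by (simp only: mult.assoc mult_1_right diff_self)
      then show ?thesis using f(1) by (metis dvd_0_right)
    next
      case (Suc m)
      have indep: False
        if f': "[:p, q:] \<in> J" "in_level d p q" "coeff p (Suc m) = 1" "coeff q m = 0"
        and g': "[:r, s:] \<in> J" "in_level d r s" "coeff r (Suc m) = 0" "coeff s m = 1"
        for p q r s
      proof -
        \<comment> \<open>The vanishing pair at level \<open>Suc d\<close> puts \<open>F\<close> in
          level \<open>d\<close>. Subtracting the combination with the same leading pair drops it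
          below \<open>d\<close>, where \<open>J\<close> has only zero.\<close>
        have span: "\<exists>x y. F = const_XY x * [:p, q:] + const_XY y * [:r, s:]"
          if F: "F = [:p', q':]" and J: "[:p', q':] \<in> J" and l: "in_level (Suc d) p' q'"
            "coeff p' (Suc d) = 0" "coeff q' d = 0" for F p' q'
        proof -
          define x y where "x = coeff p' d" "y = coeff q' m"
          let ?r = "smult 1 p' + smult (- 1) (smult x p + smult y r)"
          let ?s = "smult 1 q' + smult (- 1) (smult x q + smult y s)"
          have "in_level d ?r ?s"
            by (intro in_level_comb f' g' in_level_Suc_drop[OF l])
          then have "in_level m ?r ?s"
            unfolding Suc by (rule in_level_Suc_drop) (use f' g' in \<open>simp_all add: x_y_def Suc\<close>)
          moreover have "[:?r, ?s:] \<in> J" by (intro comb J f' g')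
          ultimately have "?r = 0" "?s = 0" using low[of ?r ?s m] Suc by auto
          then have "p' = smult x p + smult y r" "q' = smult x q + smult y s"
            by (simp_all add: algebra_simps)
          with F show ?thesis unfolding linear_comb[symmetric] by blast
        qed
        let ?f = "[:p, q:]" and ?g = "[:r, s:]"
        have q0: "coeff q (Suc (Suc m)) = 0" "coeff s (Suc (Suc m)) = 0"
          using f'(2) g'(2) by (simp_all add: in_level_def Suc)
        \<comment> \<open>The normal form of \<open>b X f + Y g\<close>; the leading pairs
          \<open>(b, 0)\<close> and \<open>(-b, 0)\<close> cancel.\<close>
        let ?r = "smult b (pCons 0 p) + smult 1 (- ([:c, 0, b:] * s))"
        let ?s = "smult b (pCons 0 q) + smult 1 r"
        have "\<exists>x y. [:?r, ?s:] = const_XY x * ?f + const_XY y * ?g"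
        proof (rule span[OF refl])
          show "[:?r, ?s:] \<in> J" by (intro comb Xmem Ymem f' g')
          show "in_level (Suc d) ?r ?s"
            by (intro in_level_comb in_level_times_X in_level_times_Y f' g')
        qed (use f' g' q0 Suc in simp_all)
        then obtain \<gamma> \<delta> where 1: "[:?r, ?s:] = const_XY \<gamma> * ?f + const_XY \<delta> * ?g" by blast
        \<comment> \<open>The normal form of \<open>X g - Y f\<close>; both terms have leading pair
          \<open>(0, 1)\<close>.\<close>
        let ?r = "smult 1 (pCons 0 r) + smult (- 1) (- ([:c, 0, b:] * q))"
        let ?s = "smult 1 (pCons 0 s) + smult (- 1) p"
        have "\<exists>x y. [:?r, ?s:] = const_XY x * ?f + const_XY y * ?g"
        proof (rule span[OF refl])
          show "[:?r, ?s:] \<in> J" by (intro comb Xmem Ymem f' g')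
          show "in_level (Suc d) ?r ?s"
            by (intro in_level_comb in_level_times_X in_level_times_Y f' g')
        qed (use f' g' q0 Suc in simp_all)
        then obtain \<alpha> \<beta> where 2: "[:?r, ?s:] = const_XY \<alpha> * ?f + const_XY \<beta> * ?g" by blast
        let ?yf = "[:- ([:c, 0, b:] * q), p:]" and ?yg = "[:- ([:c, 0, b:] * s), r:]"
        have c1: "const_XY 1 = 1" "const_XY (- 1) = - 1" by (simp_all add: const_XY_def one_pCons)
        have 1: "const_XY b * (var_X * ?f) + ?yg = const_XY \<gamma> * ?f + const_XY \<delta> * ?g"
          using 1 unfolding linear_comb linear_times_var_X c1 by (simp only: mult_1_left)
        have 2: "var_X * ?g - ?yf = const_XY \<alpha> * ?f + const_XY \<beta> * ?g"
          using 2 unfolding linear_comb linear_times_var_X c1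
          by (simp only: mult_1_left mult_minus_left diff_conv_add_uminus)
        \<comment> \<open>The determinant of the relations
          \<open>(b X - \<gamma>) f + (Y - \<delta>) g = 0\<close> and
          \<open>-(Y + \<alpha>) f + (X - \<beta>) g = 0\<close>, valid modulo
          \<open>Phi\<close>.\<close>
        define M where "M = (const_XY b * var_X - const_XY \<gamma>) * (var_X - const_XY \<beta>) +
          (var_Y - const_XY \<delta>) * (var_Y + const_XY \<alpha>)"
        \<comment> \<open>Cramer's rule for the two linear relations between \<open>f\<close> and \<open>g\<close>\<close>
        have "M * ?f = (var_X - const_XY \<beta>) *
            (const_XY b * (var_X * ?f) + ?yg - (const_XY \<gamma> * ?f + const_XY \<delta> * ?g) + (var_Y * ?g - ?yg))
          - (var_Y - const_XY \<delta>) *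
            (var_X * ?g - ?yf - (const_XY \<alpha> * ?f + const_XY \<beta> * ?g) - (var_Y * ?f - ?yf))"
          by (simp only: M_def algebra_simps)
        also have "\<dots> = (var_X - const_XY \<beta>) * (var_Y * ?g - ?yg)
          + (var_Y - const_XY \<delta>) * (var_Y * ?f - ?yf)"
          unfolding 1 2 by (simp only: algebra_simps)
        also have "?P dvd \<dots>"
          by (intro dvd_add dvd_mult linear_times_var_Y)
        finally have "?P dvd M \<or> ?P dvd ?f"
          using prime_Phi[OF bc] by (simp only: prime_elem_dvd_mult_iff)
        moreover have "\<not> ?P dvd ?f" using Phi_dvd_linear[of b c p q] f'(3) by auto
        ultimately have "?P dvd M - ?P" by (simp only: dvd_diff dvd_refl simp_thms)
        \<comment> \<open>The quadratic parts of \<open>M\<close> and \<open>Phi\<close> agree, so a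
          normal form remains and all its coefficients vanish.\<close>
        also have "M - ?P = [:[:\<gamma> * \<beta> - \<delta> * \<alpha> - c, - (\<gamma> + b * \<beta>):], [:\<alpha> - \<delta>:]:]"
          by (simp add: M_def Phi_eq const_XY_def var_X_def var_Y_def algebra_simps)
        finally have "\<gamma> * \<beta> - \<delta> * \<alpha> - c = 0" "\<gamma> = - (b * \<beta>)" "\<alpha> = \<delta>"
          using Phi_dvd_linear by fastforce+
        then have "b * \<beta>\<^sup>2 + \<alpha>\<^sup>2 + c = 0" by (simp add: power2_eq_square algebra_simps)
        moreover have "b * \<beta>\<^sup>2 \<ge> 0" using bc by simp
        ultimately show False using bc by (smt (verit) zero_le_power2)
      qed
      define u v where "u = coeff p (Suc m)" "v = coeff q m"
      \<comment> \<open>Otherwise the nonzero generator would lie in level \<open>m\<close>, below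
        the minimum \<open>d\<close>.\<close>
      have uv: "u \<noteq> 0 \<or> v \<noteq> 0"
        using low[OF f(1), of m] in_level_Suc_drop[of m p q] f(2,3) Suc by (auto simp: u_v_def)
      then have e: "u\<^sup>2 + v\<^sup>2 \<noteq> 0" by (simp add: sum_power2_eq_zero_iff)
      have dim1: "\<exists>l. r = smult l p \<and> s = smult l q"
        if g: "[:r, s:] \<in> J" "in_level d r s" for r s
      proof -
        define u' v' where "u' = coeff r (Suc m)" "v' = coeff s m"
        \<comment> \<open>The determinant of the two leading pairs. If it is nonzero, inverting the
          matrix yields elements with leading pairs \<open>(1, 0)\<close> and \<open>(0, 1)\<close>,
          which \<open>indep\<close> excludes.\<close>
        define D where "D = u * v' - u' * v"
        have "D = 0"
        proof (rule ccontr)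
          assume D: "D \<noteq> 0"
          show False
          proof (rule indep)
            let ?p = "smult (v' / D) p + smult (- v / D) r"
            let ?q = "smult (v' / D) q + smult (- v / D) s"
            let ?r = "smult (- u' / D) p + smult (u / D) r"
            let ?s = "smult (- u' / D) q + smult (u / D) s"
            show "[:?p, ?q:] \<in> J" "[:?r, ?s:] \<in> J" by (intro comb f g)+
            show "in_level d ?p ?q" "in_level d ?r ?s" by (intro in_level_comb f g)+
            show "coeff ?p (Suc m) = 1" "coeff ?q m = 0" "coeff ?r (Suc m) = 0" "coeff ?s m = 1"
              using D by (simp_all add: u_v_def[symmetric] u'_v'_def[symmetric] field_simps)
               (simp_all add: D_def algebra_simps)
          qed
        qed
        \<comment> \<open>Coefficient of the orthogonal projection onto \<open>(u, v)\<close>; it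
          works whichever of \<open>u\<close>, \<open>v\<close> is nonzero.\<close>
        define l where "l = (u * u' + v * v') / (u\<^sup>2 + v\<^sup>2)"
        let ?r = "smult 1 r + smult (- l) p" and ?s = "smult 1 s + smult (- l) q"
        have "u' * (u\<^sup>2 + v\<^sup>2) - (u * u' + v * v') * u = - v * D"
          "v' * (u\<^sup>2 + v\<^sup>2) - (u * u' + v * v') * v = u * D"
          by (simp_all add: D_def power2_eq_square algebra_simps)
        then have "u' - l * u = 0" "v' - l * v = 0" using e \<open>D = 0\<close>
          by (simp_all add: l_def field_simps)
        then have "in_level m ?r ?s"
          by (intro in_level_Suc_drop[OF in_level_comb[OF g(2)[unfolded Suc] f(3)[unfolded Suc]]])
            (simp_all add: u_v_def u'_v'_def)
        moreover have "[:?r, ?s:] \<in> J" by (intro comb f g)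
        ultimately have "?r = 0" "?s = 0" using low[of ?r ?s m] Suc by auto
        then show ?thesis by (intro exI[of _ l]) (simp_all add: algebra_simps)
      qed
      \<comment> \<open>Induction on the level: zero below \<open>d\<close>, a real multiple at
        \<open>d\<close>, and above \<open>d\<close> a multiple with the same leading pair is
        subtracted.\<close>
      have gen: "\<exists>k. ?P dvd [:r, s:] - k * [:p, q:]"
        if "[:r, s:] \<in> J" "in_level n r s" for n r s
        using that
      proof (induction n arbitrary: r s)
        case 0
        with low Suc have "r = 0 \<and> s = 0" by blast
        then show ?case by (intro exI[of _ 0]) simp
      next
        case (Suc n)
        consider "Suc n < d" | "Suc n = d" | "m < n" using \<open>d = Suc m\<close> by linarith
        then show ?case
        proof cases
          case 1
          with low Suc have "r = 0 \<and> s = 0" by blast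
          then show ?thesis by (intro exI[of _ 0]) simp
        next
          case 2
          with dim1 Suc obtain l where "r = smult l p" "s = smult l q" by blast
          then show ?thesis by (intro exI[of _ "const_XY l"]) (simp add: const_XY_def)
        next
          case 3
          from multiples_all_leads[OF bc(1) f(3)[unfolded \<open>d = Suc m\<close>] uv[unfolded u_v_def] 3]
          obtain k r' s' where k: "?P dvd [:r', s':] - k * [:p, q:]" and l: "in_level (Suc n) r' s'"
            and e: "coeff r' (Suc n) = coeff r (Suc n)" "coeff s' n = coeff s n" by blast
          let ?r = "smult 1 r + smult (- 1) r'" and ?s = "smult 1 s + smult (- 1) s'"
          have "in_level n ?r ?s"
            by (rule in_level_Suc_drop[OF in_level_comb[OF Suc.prems(2) l]]) (simp_all add: e)
          moreover have "[:r', s':] \<in> J" using mem[OF k] mult[OF f(1)] by blast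
          then have "[:?r, ?s:] \<in> J" by (intro comb Suc.prems)
          ultimately obtain k' where k': "?P dvd [:?r, ?s:] - k' * [:p, q:]" using Suc.IH by blast
          have diff: "[:?r, ?s:] = [:r, s:] - [:r', s':]" by simp
          have "[:r, s:] - (k + k') * [:p, q:]
            = ([:?r, ?s:] - k' * [:p, q:]) + ([:r', s':] - k * [:p, q:])"
            unfolding diff by (simp only: algebra_simps)
          with k k' show ?thesis by (metis dvd_add)
        qed
      qed
      have "\<exists>k. ?P dvd h - k * [:p, q:]" if h: "h \<in> J" for h
      proof -
        obtain r s where rs: "?P dvd h - [:r, s:]" using Phi_reduce by blast
        then have "[:r, s:] \<in> J" using mem[OF dvd_diff_swap h] by blast
        with gen ex_in_level obtain k where k: "?P dvd [:r, s:] - k * [:p, q:]" by blast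
        have "h - k * [:p, q:] = (h - [:r, s:]) + ([:r, s:] - k * [:p, q:])" by simp
        with rs k show ?thesis by (metis dvd_add)
      qed
      with f(1) show ?thesis by blast
    qed
  qed
qed

section \<open>Transfer to the quotient ring\<close>

lemma ring_of_type_algebra_simps:
  "carrier ring_of_type_algebra = UNIV"
  "x \<otimes>\<^bsub>ring_of_type_algebra\<^esub> y = x * y"
  "x \<oplus>\<^bsub>ring_of_type_algebra\<^esub> y = x + y"
  "\<one>\<^bsub>ring_of_type_algebra\<^esub> = 1"
  "\<zero>\<^bsub>ring_of_type_algebra\<^esub> = 0"
  by (simp_all add: ring_of_type_algebra_def)

lemma genideal_type_algebra:
  fixes P :: "'a :: comm_ring_1"
  shows "Idl\<^bsub>ring_of_type_algebra\<^esub> {P} = {x. P dvd x}"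
proof -
  interpret cring "ring_of_type_algebra :: 'a ring" by (rule cring_from_type_algebra)
  have "Idl\<^bsub>ring_of_type_algebra\<^esub> {P} = PIdl\<^bsub>ring_of_type_algebra\<^esub> P"
    by (simp add: cgenideal_eq_genideal ring_of_type_algebra_simps)
  also have "\<dots> = {x. P dvd x}"
    by (auto simp: cgenideal_def ring_of_type_algebra_simps dvd_def mult.commute)
  finally show ?thesis .
qed

locale type_quotient =
  fixes P :: "'a :: comm_ring_1" and Q :: "'a set ring" and proj :: "'a \<Rightarrow> 'a set"
  defines "Q \<equiv> ring_of_type_algebra Quot (Idl\<^bsub>ring_of_type_algebra\<^esub> {P})"
    and "proj \<equiv> \<lambda>x. Idl\<^bsub>ring_of_type_algebra\<^esub> {P} +>\<^bsub>ring_of_type_algebra\<^esub> x"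
begin

lemma ideal_genideal: "ideal (Idl\<^bsub>ring_of_type_algebra\<^esub> {P}) ring_of_type_algebra"
  by (intro ring.genideal_ideal ring_from_type_algebra) (simp add: ring_of_type_algebra_simps)

lemma cring_Q: "cring Q"
  unfolding Q_def by (intro ideal.quotient_is_cring ideal_genideal cring_from_type_algebra)

lemma proj_hom: "proj \<in> ring_hom ring_of_type_algebra Q"
  unfolding Q_def proj_def by (rule ideal.rcos_ring_hom[OF ideal_genideal])

lemma proj_eq: "proj x = {z. P dvd z - x}"
proof -
  have "z \<in> proj x \<longleftrightarrow> P dvd z - x" for z
    unfolding proj_def genideal_type_algebra
    by (auto simp: a_r_coset_def' ring_of_type_algebra_simps intro: exI[of _ "z - x"])
  then show ?thesis by blast
qed

lemma proj_eq_iff: "proj x = proj y \<longleftrightarrow> P dvd x - y"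
proof
  assume "proj x = proj y"
  moreover have "x \<in> proj x" by (simp add: proj_eq)
  ultimately show "P dvd x - y" by (simp add: proj_eq)
next
  assume "P dvd x - y"
  then have "P dvd z - x \<longleftrightarrow> P dvd z - y" for z
    using dvd_add[of P "z - x" "x - y"] dvd_diff[of P "z - y" "x - y"] by auto
  then show "proj x = proj y" by (simp add: proj_eq)
qed

lemma carrier_Q: "carrier Q = range proj"
  by (auto simp: Q_def proj_def FactRing_def A_RCOSETS_def' ring_of_type_algebra_simps)

lemma proj_mult: "proj x \<otimes>\<^bsub>Q\<^esub> proj y = proj (x * y)"
  and proj_add: "proj x \<oplus>\<^bsub>Q\<^esub> proj y = proj (x + y)"
  using ring_hom_mult[OF proj_hom] ring_hom_add[OF proj_hom]
  by (simp_all add: ring_of_type_algebra_simps)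

lemma proj_one: "\<one>\<^bsub>Q\<^esub> = proj 1"
  using ring_hom_one[OF proj_hom] by (simp add: ring_of_type_algebra_simps)

lemma proj_zero: "\<zero>\<^bsub>Q\<^esub> = proj 0"
  using ring_hom_zero[OF proj_hom ring_from_type_algebra cring.axioms(1)[OF cring_Q]]
  by (simp add: ring_of_type_algebra_simps)

lemma domain_Q:
  assumes "prime_elem P"
  shows "domain Q"
proof (rule domainI[OF cring_Q])
  show "\<one>\<^bsub>Q\<^esub> \<noteq> \<zero>\<^bsub>Q\<^esub>"
    using assms by (simp add: proj_one proj_zero proj_eq_iff prime_elem_def)
  fix a b assume ab: "a \<otimes>\<^bsub>Q\<^esub> b = \<zero>\<^bsub>Q\<^esub>" and "a \<in> carrier Q" "b \<in> carrier Q"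
  then obtain x y where xy: "a = proj x" "b = proj y" by (auto simp: carrier_Q)
  with ab have "P dvd x * y" by (simp add: proj_mult proj_zero proj_eq_iff)
  then have "P dvd x \<or> P dvd y" using prime_elem_dvd_multD[OF assms] by blast
  then show "a = \<zero>\<^bsub>Q\<^esub> \<or> b = \<zero>\<^bsub>Q\<^esub>" by (simp add: xy proj_zero proj_eq_iff)
qed

text \<open>The preimage of an ideal under \<open>proj\<close> is closed under addition and
  multiples and contains \<open>P\<close>; a generator of it modulo \<open>P\<close> projects to a
  generator.\<close>

lemma principal_domain_Q:
  assumes "prime_elem P"
    and principal: "\<And>J. (\<And>F G. F \<in> J \<Longrightarrow> G \<in> J \<Longrightarrow> F + G \<in> J) \<Longrightarrow>
      (\<And>F G. F \<in> J \<Longrightarrow> G * F \<in> J) \<Longrightarrow> P \<in> J \<Longrightarrow> \<exists>f\<in>J. \<forall>h\<in>J. \<exists>k. P dvd h - k * f"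
  shows "principal_domain Q"
proof (intro principal_domain.intro principal_domain_axioms.intro domain_Q assms(1))
  fix K assume "ideal K Q"
  then interpret K: ideal K Q .
  have "\<exists>f\<in>proj -` K. \<forall>h\<in>proj -` K. \<exists>k. P dvd h - k * f"
  proof (rule principal)
    show "F + G \<in> proj -` K" if "F \<in> proj -` K" "G \<in> proj -` K" for F G
      using additive_subgroup.a_closed[OF K.additive_subgroup_axioms, of "proj F" "proj G"] that by (simp add: proj_add)
    show "G * F \<in> proj -` K" if "F \<in> proj -` K" for F G
      using K.I_l_closed[of "proj F" "proj G"] that by (simp add: proj_mult carrier_Q)
    have "proj P = \<zero>\<^bsub>Q\<^esub>" by (simp add: proj_zero proj_eq_iff)
    then show "P \<in> proj -` K" by simp
  qed
  then obtain f where f: "proj f \<in> K" and gen: "\<And>h. proj h \<in> K \<Longrightarrow> \<exists>k. P dvd h - k * f" by auto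
  have "K = PIdl\<^bsub>Q\<^esub> (proj f)"
  proof
    show "PIdl\<^bsub>Q\<^esub> (proj f) \<subseteq> K"
      using f by (auto simp: cgenideal_def intro: K.I_l_closed)
    show "K \<subseteq> PIdl\<^bsub>Q\<^esub> (proj f)"
    proof
      fix y assume y: "y \<in> K"
      then obtain h where h: "y = proj h" using K.a_subset carrier_Q by blast
      with y gen obtain k where "P dvd h - k * f" by blast
      then have "y = proj k \<otimes>\<^bsub>Q\<^esub> proj f" by (simp add: h proj_mult proj_eq_iff)
      then show "y \<in> PIdl\<^bsub>Q\<^esub> (proj f)" unfolding cgenideal_def carrier_Q by blast
    qed
  qed
  then show "\<exists>a\<in>carrier Q. K = PIdl\<^bsub>Q\<^esub> a" by (auto simp: carrier_Q)
qed

text \<open>Supplies the division hypothesis of \<open>no_euclidean_mod_Phi\<close>, with the value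
  of a representative taken on its class.\<close>

lemma euclidean_lift:
  assumes "euclidean_domain Q \<delta>" "\<not> P dvd A" "\<not> P dvd B"
  shows "\<exists>q r. P dvd A - (B * q + r) \<and> (P dvd r \<or> \<delta> (proj r) < \<delta> (proj B))"
proof -
  interpret euclidean_domain Q \<delta> by fact
  have "proj A \<in> carrier Q - {\<zero>\<^bsub>Q\<^esub>}" "proj B \<in> carrier Q - {\<zero>\<^bsub>Q\<^esub>}"
    using assms(2,3) by (auto simp: carrier_Q proj_zero proj_eq_iff)
  from euclidean_function[OF this] obtain q r where "proj A = proj B \<otimes>\<^bsub>Q\<^esub> proj q \<oplus>\<^bsub>Q\<^esub> proj r"
    "proj r = \<zero>\<^bsub>Q\<^esub> \<or> \<delta> (proj r) < \<delta> (proj B)" by (auto simp: carrier_Q)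
  then show ?thesis by (auto simp: proj_mult proj_add proj_zero proj_eq_iff)
qed

end

theorem theorem2p19:
  fixes b c :: real
  assumes "b > 0" and "c > 0"
  shows "principal_domain (L_ring b c) \<and>
         \<not> (\<exists>\<delta> :: real poly poly set \<Rightarrow> nat. euclidean_domain (L_ring b c) \<delta>)"
proof -
  interpret type_quotient "Phi b c" "L_ring b c"
      "\<lambda>x. Idl\<^bsub>RXY\<^esub> {Phi b c} +>\<^bsub>RXY\<^esub> x"
    by unfold_locales (simp_all add: L_ring_def)
  have "principal_domain (L_ring b c)"
    by (rule principal_domain_Q[OF prime_Phi[OF assms] ideal_mod_Phi_principal[OF assms]])
  moreover have False if "euclidean_domain (L_ring b c) \<delta>" for \<delta>
    by (rule no_euclidean_mod_Phi[OF assms euclidean_lift[OF that]])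
  ultimately show ?thesis by blast
qed

end
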